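(* Let $E(q)=(q;q)_\infty$ and $R(q)=\frac{(q,q^4;q^5)_\infty}{(q^2,q^3;q^5)_\infty}$. Then $$\frac{R(q)}{R(q^2)R(q^4)}-\frac{q^2R(q^2)R(q^4)}{R(q)}=\frac{E(q)E(q^4)E(q^{10})^{10}}{E(q^2)^2E(q^5)^5E(q^{20})^5}.$$ Moreover, $$\left(\frac{1}{R(q)R(q^4)}+q^2R(q)R(q^4)\right)-\left(\frac{R(q)}{R(q^2)R(q^4)}-\frac{q^2R(q^2)R(q^4)}{R(q)}\right)=2q.$$
   Context: $(A;q)_\infty=\prod_{k\ge0}(1-Aq^k)$, $(A_1,\dots,A_n;q)_\infty=\prod_i(A_i;q)_\infty$; identities are of formal power series in $q$. *)

theory Defs
  imports "HOL-Analysis.Analysis"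
begin

text \<open>
  The infinite product is taken in the \<open>q\<close>-adic topology of the ring of formal power series
  (the metric space instance of \<^typ>\<open>'a fps\<close>).  The base \<open>Q\<close> is itself a power series, so that
  \<open>E(q\<^sup>k)\<close> is \<open>E_fun (fps_X ^ k)\<close>; the products converge whenever \<open>Q\<close> and \<open>A\<close> have zero constant term.
\<close>

definition qpoch_inf :: "'a::field_char_0 fps \<Rightarrow> 'a fps \<Rightarrow> 'a fps" where
  "qpoch_inf A Q = (\<Prod>k. 1 - A * Q ^ k)"

definition qpochs_inf :: "'a::field_char_0 fps list \<Rightarrow> 'a fps \<Rightarrow> 'a fps" where
  "qpochs_inf As Q = (\<Prod>A\<leftarrow>As. qpoch_inf A Q)"

definition E_fun :: "'a::field_char_0 fps \<Rightarrow> 'a fps" where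
  "E_fun Q = qpoch_inf Q Q"

definition R_fun :: "'a::field_char_0 fps \<Rightarrow> 'a fps" where
  "R_fun Q = qpochs_inf [Q, Q ^ 4] (Q ^ 5) / qpochs_inf [Q ^ 2, Q ^ 3] (Q ^ 5)"

lemma qpoch_inf_has_prod:
  fixes A Q :: "'a::field_char_0 fps"
  assumes A: "fps_nth A 0 = 0" and Q: "fps_nth Q 0 = 0"
  shows "(\<lambda>k. 1 - A * Q ^ k) has_prod qpoch_inf A Q" and "fps_nth (qpoch_inf A Q) 0 = 1"
proof -
  define P where "P = (\<lambda>n. \<Prod>k\<le>n. 1 - A * Q ^ k)"
  define L where "L = Abs_fps (\<lambda>i. fps_nth (P i) i)"
  have step: "fps_nth (P (Suc n)) i = fps_nth (P n) i" if "i \<le> n" for n i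
  proof -
    have z: "fps_nth (Q ^ Suc n) j = 0" if "j \<le> n" for j
      using Q that by (intro startsby_zero_power_prefix[rule_format]) auto
    have "P (Suc n) = P n - (P n * A) * Q ^ Suc n"
      by (simp add: P_def algebra_simps)
    moreover have "fps_nth ((P n * A) * Q ^ Suc n) i = 0"
      unfolding fps_mult_nth using z that by (intro sum.neutral) auto
    ultimately show ?thesis by simp
  qed
  have stable: "fps_nth (P n) i = fps_nth L i" if "i \<le> n" for n i
    using that
  proof (induction n rule: dec_induct)
    case base then show ?case by (simp add: L_def)
  next
    case (step n) then show ?case using \<open>\<And>n i. i \<le> n \<Longrightarrow> fps_nth (P (Suc n)) i = fps_nth (P n) i\<close> by simp
  qed
  have L0: "fps_nth L 0 = 1" using A by (simp add: L_def P_def)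
  have "P \<longlonglongrightarrow> L"
    by (rule tendsto_fpsI) (auto simp: eventually_sequentially intro!: stable)
  moreover have "L \<noteq> 0" using L0 by auto
  ultimately have hp: "(\<lambda>k. 1 - A * Q ^ k) has_prod L"
    by (simp add: has_prod_def raw_has_prod_def P_def)
  moreover have "qpoch_inf A Q = L"
    unfolding qpoch_inf_def prodinf_def
  proof (rule the_equality[where P = "\<lambda>p. (\<lambda>k. 1 - A * Q ^ k) has_prod p", OF hp])
    fix p assume "(\<lambda>k. 1 - A * Q ^ k) has_prod p"
    moreover have "1 - A * Q ^ k \<noteq> 0" for k
    proof
      assume "1 - A * Q ^ k = 0"
      then have "fps_nth (1 - A * Q ^ k) 0 = 0" by simp
      then show False using A by simp
    qed
    ultimately have "P \<longlonglongrightarrow> p"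
      by (auto simp: has_prod_def raw_has_prod_def P_def)
    with \<open>P \<longlonglongrightarrow> L\<close> show "p = L" by (rule LIMSEQ_unique[rotated])
  qed
  ultimately show "(\<lambda>k. 1 - A * Q ^ k) has_prod qpoch_inf A Q" "fps_nth (qpoch_inf A Q) 0 = 1"
    using L0 by simp_all
qed

end

theory Submission
  imports Defs
begin

text \<open>
  Write \<open>T\<^sub>j = (q\<^sup>j, q\<^sup>1\<^sup>0\<^sup>-\<^sup>j, q\<^sup>1\<^sup>0; q\<^sup>1\<^sup>0)\<close>, so that \<open>R(q) = T\<^sub>1 T\<^sub>4 / (T\<^sub>2 T\<^sub>3)\<close> and
  \<open>R(q\<^sup>2) = T\<^sub>2 / T\<^sub>4\<close>.  By the Jacobi triple product each \<open>T\<^sub>j\<close> is a theta series, and splitting the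
  double sum for \<open>T\<^sub>i T\<^sub>j\<close> by parity expresses these products through one-dimensional series; in this
  form \<open>T\<^sub>3 T\<^sub>4 - q T\<^sub>1 T\<^sub>2\<close> and \<open>T\<^sub>3 T\<^sub>4 + q T\<^sub>1 T\<^sub>2\<close> factor, and they turn out to be
  quotients of products of the \<open>T\<^sub>j\<close>.
  With \<open>U = R(q)\<close>, \<open>V = R(q\<^sup>2)\<close>, \<open>k = q U V\<^sup>2\<close> this yields Rogers' modular equation
  \<open>(1 - k) V = (1 + k) U\<^sup>2\<close> together with \<open>(1 - k\<^sup>2) / (U V\<^sup>2) = E(q\<^sup>2) E(q\<^sup>5)\<^sup>5 / (E(q) E(q\<^sup>1\<^sup>0)\<^sup>5)\<close>.
  Eliminating between these relations for \<open>q\<close> and for \<open>q\<^sup>2\<close> gives both identities; the eta quotient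
  of the theorem is the ratio of the two quotients.
\<close>

section \<open>Formal power series indexed by a set\<close>

text \<open>The sum of \<open>c i X\<^sup>e\<^sup>(\<^sup>i\<^sup>)\<close> over \<open>i \<in> I\<close>; infinite fibres of \<open>e\<close> contribute the junk value 0.\<close>

definition psum :: "'i set \<Rightarrow> ('i \<Rightarrow> 'a::comm_ring_1) \<Rightarrow> ('i \<Rightarrow> nat) \<Rightarrow> 'a fps" where
  "psum I c e = Abs_fps (\<lambda>N. \<Sum>i\<in>{i\<in>I. e i = N}. c i)"

definition fin_fibres :: "'i set \<Rightarrow> ('i \<Rightarrow> nat) \<Rightarrow> bool" where
  "fin_fibres I e \<longleftrightarrow> (\<forall>N. finite {i\<in>I. e i = N})"

text \<open>Cauchy product: the pairs of total exponent \<open>N\<close> form a disjoint union of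
  rectangles of fibres. These are finite by hypothesis, so the default value of an infinite sum
  never enters.\<close>

lemma psum_mult:
  assumes "fin_fibres I e" "fin_fibres J f"
  shows "psum I c e * psum J d f = psum (I \<times> J) (\<lambda>(i, j). c i * d j) (\<lambda>(i, j). e i + f j)"
proof (rule fps_ext)
  fix N
  let ?I = "\<lambda>k. {i\<in>I. e i = k}" and ?J = "\<lambda>k. {j\<in>J. f j = k}"
  have fin: "finite (?I k)" "finite (?J k)" for k
    using assms by (auto simp: fin_fibres_def)
  have eq: "{p\<in>I \<times> J. (\<lambda>(i, j). e i + f j) p = N} = (\<Union>k\<in>{0..N}. ?I k \<times> ?J (N - k))"
    by auto
  have "fps_nth (psum I c e * psum J d f) N
      = (\<Sum>k=0..N. \<Sum>p\<in>?I k \<times> ?J (N - k). (\<lambda>(i, j). c i * d j) p)"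
    by (simp add: fps_mult_nth psum_def sum_product sum.cartesian_product)
  also have "\<dots> = (\<Sum>p\<in>(\<Union>k\<in>{0..N}. ?I k \<times> ?J (N - k)). (\<lambda>(i, j). c i * d j) p)"
    using fin by (intro sum.UNION_disjoint[symmetric]) auto
  finally show "fps_nth (psum I c e * psum J d f) N
      = fps_nth (psum (I \<times> J) (\<lambda>(i, j). c i * d j) (\<lambda>(i, j). e i + f j)) N"
    unfolding eq[symmetric] by (simp add: psum_def)
qed

lemma fin_fibres_Times:
  assumes "fin_fibres I e" "fin_fibres J f"
  shows "fin_fibres (I \<times> J) (\<lambda>(i, j). e i + f j)"
  unfolding fin_fibres_def
proof
  fix N
  have "{p\<in>I \<times> J. (\<lambda>(i, j). e i + f j) p = N}
      = (\<Union>k\<in>{0..N}. {i\<in>I. e i = k} \<times> {j\<in>J. f j = N - k})"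
    by auto
  then show "finite {p\<in>I \<times> J. (\<lambda>(i, j). e i + f j) p = N}"
    using assms by (auto simp: fin_fibres_def)
qed

lemma psum_reindex:
  assumes "bij_betw h J I" "\<And>j. j \<in> J \<Longrightarrow> c (h j) = d j" "\<And>j. j \<in> J \<Longrightarrow> e (h j) = f j"
  shows "psum I c e = psum J d f"
proof (rule fps_ext)
  fix N
  have "bij_betw h {j\<in>J. f j = N} {i\<in>I. e i = N}"
    using assms(1,3) by (auto simp: bij_betw_def inj_on_def)
  then have "(\<Sum>i\<in>{i\<in>I. e i = N}. c i) = (\<Sum>j\<in>{j\<in>J. f j = N}. c (h j))"
    by (rule sum.reindex_bij_betw[symmetric])
  also have "\<dots> = (\<Sum>j\<in>{j\<in>J. f j = N}. d j)"
    using assms(2) by (intro sum.cong) auto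
  finally show "fps_nth (psum I c e) N = fps_nth (psum J d f) N"
    by (simp add: psum_def)
qed

lemma psum_Un_disjoint:
  assumes "fin_fibres (I \<union> J) e" "I \<inter> J = {}"
  shows "psum (I \<union> J) c e = psum I c e + psum J c e"
proof (rule fps_ext)
  fix N
  have "{i\<in>I \<union> J. e i = N} = {i\<in>I. e i = N} \<union> {i\<in>J. e i = N}"
    by auto
  moreover have "finite {i\<in>I \<union> J. e i = N}"
    using assms(1) by (auto simp: fin_fibres_def)
  ultimately show "fps_nth (psum (I \<union> J) c e) N = fps_nth (psum I c e + psum J c e) N"
    using assms(2) by (auto simp: psum_def intro!: sum.union_disjoint)
qed

lemma fps_X_power_mult_psum: "fps_X ^ k * psum I c e = psum I c (\<lambda>i. k + e i)"
proof (rule fps_ext)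
  fix N
  have "{i\<in>I. k + e i = N} = (if N < k then {} else {i\<in>I. e i = N - k})"
    by auto
  then show "fps_nth (fps_X ^ k * psum I c e) N = fps_nth (psum I c (\<lambda>i. k + e i)) N"
    by (simp add: psum_def fps_X_power_mult_nth)
qed

lemma uminus_psum: "- psum I c e = psum I (\<lambda>i. - c i) e"
  by (rule fps_ext) (simp add: psum_def sum_negf)

section \<open>Theta series\<close>

text \<open>The truncation by \<open>nat\<close> is harmless for \<open>0 < i < 2 h\<close> and for \<open>\<alpha> < 2 h\<close>, when the exponents
  are nonnegative.\<close>

definition theta :: "nat \<Rightarrow> nat \<Rightarrow> 'a::comm_ring_1 fps" where
  "theta h i = psum (UNIV :: int set) (\<lambda>n. if even n then 1 else - 1)
     (\<lambda>n. nat (int h * n * (n - 1) + int i * n))"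

text \<open>Ramanujan's theta function f(a, b) at a = q^(2h + \<alpha>), b = q^(2h - \<alpha>), with
  all signs positive.\<close>

definition gauss_sum :: "nat \<Rightarrow> nat \<Rightarrow> 'a::comm_ring_1 fps" where
  "gauss_sum h \<alpha> = psum (UNIV :: int set) (\<lambda>_. 1) (\<lambda>n. nat (2 * int h * n\<^sup>2 + int \<alpha> * n))"

text \<open>The bound by |n| serves twice: it makes the fibres of the exponent finite, and it allows
  the bilateral series to be cut to the indices from -n to n modulo X^n.\<close>

lemma theta_exponent_ge:
  fixes n :: int
  assumes "0 < i" "i < 2 * h"
  shows "\<bar>n\<bar> \<le> int h * n * (n - 1) + int i * n"
proof (cases "n \<ge> 0")
  case True
  then have "0 \<le> n * (n - 1)"
    by (cases "n = 0") auto
  then have "0 \<le> int h * (n * (n - 1))"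
    by simp
  moreover have "1 * n \<le> int i * n"
    using True assms by (intro mult_right_mono) auto
  ultimately show ?thesis
    using True by (simp add: mult.assoc)
next
  case False
  then have "0 \<le> int h * (- n * (- n - 1))"
    by (intro mult_nonneg_nonneg) auto
  moreover have "int i * - n \<le> (2 * int h - 1) * - n"
    using False assms by (intro mult_right_mono) auto
  ultimately show ?thesis
    using False by (simp add: algebra_simps)
qed

lemma gauss_exponent_ge:
  fixes n :: int
  assumes "\<alpha> < 2 * h"
  shows "\<bar>n\<bar> \<le> 2 * int h * n\<^sup>2 + int \<alpha> * n"
proof -
  have "\<bar>n\<bar> \<le> n\<^sup>2"
  proof (cases "n = 0")
    case False
    then have "1 * \<bar>n\<bar> \<le> \<bar>n\<bar> * \<bar>n\<bar>"
      by (intro mult_right_mono) auto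
    then show ?thesis by (simp add: power2_eq_square)
  qed simp
  then have "2 * int h * \<bar>n\<bar> \<le> 2 * int h * n\<^sup>2"
    by (intro mult_left_mono) auto
  moreover have "(int \<alpha> + 1) * \<bar>n\<bar> \<le> 2 * int h * \<bar>n\<bar>"
    using assms by (intro mult_right_mono) auto
  moreover have "int \<alpha> * - n \<le> int \<alpha> * \<bar>n\<bar>"
    by (intro mult_left_mono) auto
  ultimately show ?thesis
    by (simp add: algebra_simps)
qed

lemma fin_fibresI:
  fixes e :: "int \<Rightarrow> int"
  assumes "\<And>n. \<bar>n\<bar> \<le> e n"
  shows "fin_fibres UNIV (\<lambda>n. nat (e n))"
  unfolding fin_fibres_def
proof
  fix N
  have "{n\<in>UNIV. nat (e n) = N} \<subseteq> {- int N..int N}"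
  proof
    fix n assume "n \<in> {n\<in>UNIV. nat (e n) = N}"
    then show "n \<in> {- int N..int N}" using assms[of n] by auto
  qed
  then show "finite {n\<in>UNIV. nat (e n) = N}"
    by (rule finite_subset) simp
qed

text \<open>Pairs \<open>(m, n)\<close> of equal parity are parametrised by \<open>(b - a, - a - b)\<close>, those of
  opposite parity by \<open>(a - b, a + b + 1)\<close>; either way the quadratic form becomes diagonal.\<close>

lemma theta_mult_theta:
  assumes "0 < j" "j < i" "i + j < 2 * h"
  shows "theta h i * theta h j =
    (gauss_sum h (2 * h - i - j) * gauss_sum h (i - j)
      - fps_X ^ j * (gauss_sum h (i + j) * gauss_sum h (2 * h - i + j)) :: 'a::comm_ring_1 fps)"
proof -
  let ?e = "\<lambda>i n. int h * n * (n - 1) + int i * n"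
  let ?g = "\<lambda>\<alpha> n. 2 * int h * n\<^sup>2 + int \<alpha> * n"
  let ?s = "\<lambda>n::int. if even n then 1 else - 1 :: 'a"
  let ?c = "\<lambda>(m, n). ?s m * ?s n"
  let ?E = "\<lambda>(m, n). nat (?e i m) + nat (?e j n)"
  let ?Ev = "{(m, n). even (m + n)} :: (int \<times> int) set"
  let ?Od = "{(m, n). odd (m + n)} :: (int \<times> int) set"
  have le: "\<bar>n\<bar> \<le> ?e i n" "\<bar>n\<bar> \<le> ?e j n"
      "\<bar>n\<bar> \<le> ?g (2 * h - i - j) n" "\<bar>n\<bar> \<le> ?g (i - j) n"
      "\<bar>n\<bar> \<le> ?g (i + j) n" "\<bar>n\<bar> \<le> ?g (2 * h - i + j) n" for n
    by (intro theta_exponent_ge gauss_exponent_ge; use assms in linarith)+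
  \<comment> \<open>\<open>nat\<close> is additive only on nonnegative integers, so these facts let
    the exponent identities be checked in \<open>int\<close>.\<close>
  have nn: "0 \<le> ?e i n" "0 \<le> ?e j n"
      "0 \<le> ?g (2 * h - i - j) n" "0 \<le> ?g (i - j) n"
      "0 \<le> ?g (i + j) n" "0 \<le> ?g (2 * h - i + j) n" for n
    using le[of n] by linarith+
  have diffs: "int (2 * h - i - j) = 2 * int h - int i - int j" "int (i - j) = int i - int j"
      "int (2 * h - i + j) = 2 * int h - int i + int j"
    using assms by auto
  note ff = fin_fibresI[OF le(1)] fin_fibresI[OF le(2)]
  note fg = fin_fibresI[OF le(3)] fin_fibresI[OF le(4)] fin_fibresI[OF le(5)] fin_fibresI[OF le(6)]
  have ev: "gauss_sum h (2 * h - i - j) * gauss_sum h (i - j) = psum ?Ev ?c ?E"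
    unfolding gauss_sum_def psum_mult[OF fg(1,2)]
  proof (rule psum_reindex[symmetric, where h = "\<lambda>(a, b). (b - a, - a - b)"])
    show "bij_betw (\<lambda>(a, b). (b - a, - a - b)) (UNIV \<times> UNIV) ?Ev"
      by (rule bij_betwI[where g = "\<lambda>(m, n). (- ((m + n) div 2), m - (m + n) div 2)"])
        (clarsimp; presburger)+
  next
    fix p :: "int \<times> int"
    obtain a b where p: "p = (a, b)" by force
    have "?e i (b - a) + ?e j (- a - b) = ?g (2 * h - i - j) a + ?g (i - j) b"
      unfolding diffs by (simp add: algebra_simps power2_eq_square)
    then show "?E ((\<lambda>(a, b). (b - a, - a - b)) p) =
        (\<lambda>(a, b). nat (?g (2 * h - i - j) a) + nat (?g (i - j) b)) p"
      unfolding p prod.case nat_add_distrib[OF nn(1) nn(2), symmetric]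
        nat_add_distrib[OF nn(3) nn(4), symmetric]
      by (rule arg_cong)
  next
    fix p :: "int \<times> int"
    show "?c ((\<lambda>(a, b). (b - a, - a - b)) p) = (\<lambda>(a, b). 1 * 1) p"
      by (cases p) simp
  qed
  \<comment> \<open>Opposite parities make the product of the two signs -1, hence the minus. The
    factor \<open>fps_X ^ j\<close> is the lowest term of the parametrisation: a = b = 0 is the pair
    (0, 1), of exponent j.\<close>
  have od: "- (fps_X ^ j * (gauss_sum h (i + j) * gauss_sum h (2 * h - i + j))) = psum ?Od ?c ?E"
    unfolding gauss_sum_def psum_mult[OF fg(3,4)] fps_X_power_mult_psum uminus_psum
  proof (rule psum_reindex[symmetric, where h = "\<lambda>(a, b). (a - b, a + b + 1)"])
    show "bij_betw (\<lambda>(a, b). (a - b, a + b + 1)) (UNIV \<times> UNIV) ?Od"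
      by (rule bij_betwI[where g = "\<lambda>(m, n). ((m + n) div 2, (m + n) div 2 - m)"])
        (clarsimp; presburger)+
  next
    fix p :: "int \<times> int"
    obtain a b where p: "p = (a, b)" by force
    have "?e i (a - b) + ?e j (a + b + 1) = int j + (?g (i + j) a + ?g (2 * h - i + j) b)"
      unfolding diffs by (simp add: algebra_simps power2_eq_square)
    then show "?E ((\<lambda>(a, b). (a - b, a + b + 1)) p) =
        j + (\<lambda>(a, b). nat (?g (i + j) a) + nat (?g (2 * h - i + j) b)) p"
      unfolding p prod.case nat_add_distrib[OF nn(1) nn(2), symmetric]
        nat_add_distrib[OF nn(5) nn(6), symmetric]
      using nn(5)[of a] nn(6)[of b] by (simp only: nat_add_distrib nat_int add_nonneg_nonneg of_nat_0_le_iff)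
  next
    fix p :: "int \<times> int"
    show "?c ((\<lambda>(a, b). (a - b, a + b + 1)) p) = - (\<lambda>(a, b). 1 * 1) p"
      by (cases p) simp
  qed
  have "theta h i * theta h j = psum (?Ev \<union> ?Od) ?c ?E"
    unfolding theta_def psum_mult[OF ff] by (rule arg_cong[where f = "\<lambda>I. psum I _ _"]) auto
  also have "\<dots> = psum ?Ev ?c ?E + psum ?Od ?c ?E"
  proof (rule psum_Un_disjoint)
    have "?Ev \<union> ?Od = UNIV \<times> UNIV" by auto
    then show "fin_fibres (?Ev \<union> ?Od) ?E"
      using fin_fibres_Times[OF ff] by simp
  qed auto
  finally show ?thesis
    unfolding ev[symmetric] od[symmetric] by simp
qed

section \<open>Infinite products modulo powers of X\<close>

text \<open>From here on, divisibility of a difference by X^n plays the role of congruence modulo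
  X^n and replaces limit arguments.\<close>

lemma fps_X_power_dvd_iff:
  fixes F :: "'a::comm_ring_1 fps"
  shows "fps_X ^ n dvd F \<longleftrightarrow> (\<forall>i<n. fps_nth F i = 0)"
proof
  assume "\<forall>i<n. fps_nth F i = 0"
  then have "F = fps_X ^ n * fps_shift n F"
    by (auto simp: fps_eq_iff fps_X_power_mult_nth)
  then show "fps_X ^ n dvd F"
    by (rule dvdI)
qed (auto simp: fps_X_power_mult_nth elim!: dvdE)

lemma fps_eqI_mod_X_power:
  fixes F G :: "'a::comm_ring_1 fps"
  assumes "\<And>n. fps_X ^ n dvd F - G"
  shows "F = G"
proof (rule fps_ext)
  fix n show "fps_nth F n = fps_nth G n"
    using assms[of "Suc n"] unfolding fps_X_power_dvd_iff by auto
qed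

lemma dvd_diff_trans:
  fixes d :: "'a::comm_ring_1"
  assumes "d dvd x - y" "d dvd y - z"
  shows "d dvd x - z"
  using dvd_add[OF assms] by simp

lemma dvd_diff_sym:
  fixes d :: "'a::comm_ring_1"
  assumes "d dvd x - y"
  shows "d dvd y - x"
  using assms by (subst dvd_minus_iff[symmetric]) simp

lemma dvd_diff_mult:
  fixes d :: "'a::comm_ring_1"
  assumes "d dvd x - y" "d dvd z - w"
  shows "d dvd x * z - y * w"
proof -
  have "x * z - y * w = (x - y) * z + y * (z - w)"
    by (simp add: algebra_simps)
  then show ?thesis using assms by simp
qed

lemma dvd_diff_prod:
  fixes d :: "'a::comm_ring_1"
  assumes "\<And>i. i \<in> I \<Longrightarrow> d dvd f i - g i"
  shows "d dvd prod f I - prod g I"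
  using assms by (induction I rule: infinite_finite_induct) (simp_all add: dvd_diff_mult)

lemma prod_lessThan_add:
  fixes f :: "nat \<Rightarrow> 'a::comm_monoid_mult"
  shows "prod f {..<n + m} = prod f {..<n} * (\<Prod>k<m. f (n + k))"
  by (induction m) (auto simp: mult.assoc)

lemma fps_X_power_dvd_power:
  fixes Q :: "'a::comm_ring_1 fps"
  assumes "fps_nth Q 0 = 0" "n \<le> k"
  shows "fps_X ^ n dvd Q ^ k"
proof -
  have "fps_X ^ 1 dvd Q"
    using assms unfolding fps_X_power_dvd_iff by simp
  then have "fps_X ^ n dvd Q ^ n"
    using dvd_power_same by fastforce
  then show ?thesis
    using assms(2) by (meson dvd_trans le_imp_power_dvd)
qed

text \<open>Convergence makes all sufficiently long partial products agree with the limit modulo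
  X^n. Since X^n divides \<open>Q ^ k\<close> for k at least n, the partial products are already
  stationary from length n on.\<close>

lemma qpoch_inf_mod_X_power:
  fixes A Q :: "'a::field_char_0 fps"
  assumes A: "fps_nth A 0 = 0" and Q: "fps_nth Q 0 = 0" and "n \<le> M"
  shows "fps_X ^ n dvd qpoch_inf A Q - (\<Prod>k<M. 1 - A * Q ^ k)"
proof -
  define P where "P = (\<lambda>M. \<Prod>k<M. 1 - A * Q ^ k)"
  \<comment> \<open>\<open>has_prod\<close> tolerates finitely many zero factors; excluding them
    turns it into plain convergence of the partial products to the value.\<close>
  have "1 - A * Q ^ k \<noteq> 0" for k
  proof
    assume "1 - A * Q ^ k = 0"
    then have "fps_nth (1 - A * Q ^ k) 0 = 0" by simp
    then show False using A by simp
  qed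
  then have "(\<lambda>n. \<Prod>k\<le>n. 1 - A * Q ^ k) \<longlonglongrightarrow> qpoch_inf A Q"
    using qpoch_inf_has_prod(1)[OF A Q] by (auto simp: has_prod_def raw_has_prod_def)
  then have "eventually (\<lambda>m. \<forall>i\<in>{..<n}. fps_nth (\<Prod>k\<le>m. 1 - A * Q ^ k) i
      = fps_nth (qpoch_inf A Q) i) sequentially"
    by (subst eventually_ball_finite_distrib) (auto simp: tendsto_fps_iff)
  then obtain m0 where m0: "\<And>m i. m0 \<le> m \<Longrightarrow> i < n \<Longrightarrow>
      fps_nth (P (Suc m)) i = fps_nth (qpoch_inf A Q) i"
    unfolding eventually_sequentially P_def lessThan_Suc_atMost by blast
  have step: "fps_X ^ n dvd P (n + j) - P n" for j
  proof (induction j)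
    case (Suc j)
    have "fps_X ^ n dvd Q ^ (n + j)"
      using Q by (intro fps_X_power_dvd_power) auto
    then have "fps_X ^ n dvd P (n + Suc j) - P (n + j)"
      by (simp add: P_def algebra_simps)
    then show ?case using Suc.IH by (rule dvd_diff_trans)
  qed simp
  have "fps_X ^ n dvd qpoch_inf A Q - P (n + Suc m0)"
    unfolding fps_X_power_dvd_iff using m0[of "n + m0"] by simp
  from dvd_diff_trans[OF dvd_diff_trans[OF this step] dvd_diff_sym[OF step[of "M - n"]]]
  show ?thesis using \<open>n \<le> M\<close> by (simp add: P_def)
qed

text \<open>Sort the factors by the residue of their index modulo \<open>m\<close>; truncating each
  of the m products at n corresponds to truncating the single one at \<open>n * m\<close>.\<close>

lemma qpoch_inf_dissect:
  fixes A Q :: "'a::field_char_0 fps"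
  assumes A: "fps_nth A 0 = 0" and Q: "fps_nth Q 0 = 0" and m: "0 < m"
  shows "qpoch_inf A Q = (\<Prod>j<m. qpoch_inf (A * Q ^ j) (Q ^ m))"
proof (rule fps_eqI_mod_X_power)
  fix n
  have "(\<Prod>j<m. \<Prod>k<n. 1 - A * Q ^ j * (Q ^ m) ^ k)
      = (\<Prod>k<n. \<Prod>j<m. 1 - A * Q ^ (k * m + j))"
    by (subst prod.swap) (simp add: power_add power_mult mult_ac flip: power_mult)
  also have "\<dots> = (\<Prod>k<n * m. 1 - A * Q ^ k)"
  proof (induction n)
    case (Suc n)
    have "Suc n * m = n * m + m" by simp
    then show ?case using Suc by (simp only: prod.lessThan_Suc prod_lessThan_add)
  qed simp
  finally have eq: "(\<Prod>j<m. \<Prod>k<n. 1 - A * Q ^ j * (Q ^ m) ^ k) = (\<Prod>k<n * m. 1 - A * Q ^ k)" .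
  have "fps_X ^ n dvd (\<Prod>j<m. qpoch_inf (A * Q ^ j) (Q ^ m))
      - (\<Prod>j<m. \<Prod>k<n. 1 - A * Q ^ j * (Q ^ m) ^ k)"
    using A Q m by (intro dvd_diff_prod qpoch_inf_mod_X_power) auto
  moreover have "fps_X ^ n dvd qpoch_inf A Q - (\<Prod>k<n * m. 1 - A * Q ^ k)"
    using A Q m by (intro qpoch_inf_mod_X_power) auto
  ultimately show "fps_X ^ n dvd qpoch_inf A Q - (\<Prod>j<m. qpoch_inf (A * Q ^ j) (Q ^ m))"
    unfolding eq using dvd_diff_trans dvd_diff_sym by blast
qed

section \<open>The Jacobi triple product\<close>

text \<open>Defined by the q-Pascal recursion, which makes sense in any commutative ring, without
  quotients.\<close>

fun qbinomial :: "'a::comm_ring_1 \<Rightarrow> nat \<Rightarrow> nat \<Rightarrow> 'a" where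
  "qbinomial q M 0 = 1"
| "qbinomial q 0 (Suc r) = 0"
| "qbinomial q (Suc M) (Suc r) = qbinomial q M r + q ^ Suc r * qbinomial q M (Suc r)"

lemma qbinomial_eq_0: "M < r \<Longrightarrow> qbinomial q M r = 0"
  by (induction q M r rule: qbinomial.induct) auto

text \<open>The quotient formula with denominators cleared. In the recursion it comes down to (1 -
  q^(r+1)) + q^(r+1) (1 - q^(M-r)) = 1 - q^(M+1).\<close>

lemma qbinomial_mult_qpoch:
  fixes q :: "'a::comm_ring_1"
  assumes "r \<le> M"
  shows "qbinomial q M r * (\<Prod>k<r. 1 - q ^ Suc k) * (\<Prod>k<M - r. 1 - q ^ Suc k)
    = (\<Prod>k<M. 1 - q ^ Suc k)"
  using assms
proof (induction q M r rule: qbinomial.induct)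
  case (3 q M r)
  let ?P = "\<lambda>n. \<Prod>k<n. 1 - q ^ Suc k"
  have IH1: "qbinomial q M r * ?P r * ?P (M - r) = ?P M"
    using 3 by simp
  show ?case
  proof (cases "r = M")
    case True
    have "qbinomial q (Suc M) (Suc r) * ?P (Suc r) * ?P (Suc M - Suc r)
        = (qbinomial q M r * ?P r * ?P (M - r)) * (1 - q ^ Suc r)"
      using True by (simp add: qbinomial_eq_0 mult_ac)
    then show ?thesis
      unfolding IH1 using True by simp
  next
    case False
    then obtain t where "M = r + Suc t"
      using 3 less_imp_Suc_add[of r M] by auto
    then have t: "M - r = Suc t" "M - Suc r = t" "Suc M = Suc r + Suc t"
      by auto
    have IH2: "qbinomial q M (Suc r) * ?P (Suc r) * ?P t = ?P M"
      using 3 False t by simp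
    have "qbinomial q (Suc M) (Suc r) * ?P (Suc r) * ?P (Suc M - Suc r)
        = (qbinomial q M r * ?P r * ?P (M - r)) * (1 - q ^ Suc r)
          + q ^ Suc r * (qbinomial q M (Suc r) * ?P (Suc r) * ?P t) * (1 - q ^ Suc t)"
      by (simp add: t(1)) (simp add: algebra_simps)
    also have "\<dots> = ?P M * (1 - q ^ (Suc r + Suc t))"
      unfolding IH1 IH2 by (simp add: algebra_simps power_add)
    finally show ?thesis
      unfolding t(3)[symmetric] by simp
  qed
qed auto

text \<open>The form homogeneous in \<open>a\<close> and \<open>b\<close> avoids negative powers
  later, where \<open>a\<close> becomes \<open>Q ^ n\<close>. Splitting off the factor k = 0 turns
  \<open>b\<close> into \<open>b * q\<close>, so the induction runs over all
  \<open>b\<close>.\<close>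

theorem qbinomial_theorem:
  fixes a b q :: "'a::comm_ring_1"
  shows "(\<Prod>k<M. a + b * q ^ k)
    = (\<Sum>j\<le>M. qbinomial q M j * q ^ (j choose 2) * a ^ (M - j) * b ^ j)"
proof (induction M arbitrary: b)
  case (Suc M)
  let ?t = "\<lambda>j. qbinomial q M j * q ^ (j choose 2) * q ^ j * a ^ (M - j) * b ^ j"
  have "(\<Prod>k<Suc M. a + b * q ^ k) = (a + b) * (\<Prod>k<M. a + (b * q) * q ^ k)"
    by (subst prod.lessThan_Suc_shift) (simp add: mult_ac)
  also have "(\<Prod>k<M. a + (b * q) * q ^ k) = (\<Sum>j\<le>M. ?t j)"
    unfolding Suc.IH by (simp add: power_mult_distrib mult_ac)
  also have "(a + b) * (\<Sum>j\<le>M. ?t j) = (\<Sum>j\<le>M. a * ?t j) + (\<Sum>j\<le>M. b * ?t j)"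
    by (simp add: distrib_right sum_distrib_left sum.distrib)
  also have "(\<Sum>j\<le>M. a * ?t j) = (\<Sum>j\<le>Suc M. a * ?t j)"
    by (simp add: qbinomial_eq_0)
  also have "\<dots> = a ^ Suc M + (\<Sum>j\<le>M. a * ?t (Suc j))"
    by (subst sum.atMost_Suc_shift) (simp add: numeral_2_eq_2)
  also have "a ^ Suc M + (\<Sum>j\<le>M. a * ?t (Suc j)) + (\<Sum>j\<le>M. b * ?t j)
      = a ^ Suc M + (\<Sum>j\<le>M. a * ?t (Suc j) + b * ?t j)"
    by (simp add: sum.distrib)
  also have "(\<Sum>j\<le>M. a * ?t (Suc j) + b * ?t j) = (\<Sum>j\<le>M. qbinomial q (Suc M) (Suc j)
      * q ^ (Suc j choose 2) * a ^ (Suc M - Suc j) * b ^ Suc j)"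
  proof (intro sum.cong refl)
    fix j assume "j \<in> {..M}"
    then have "j \<le> M" by simp
    then show "a * ?t (Suc j) + b * ?t j = qbinomial q (Suc M) (Suc j)
        * q ^ (Suc j choose 2) * a ^ (Suc M - Suc j) * b ^ Suc j"
    proof (cases "j = M")
      case False
      with \<open>j \<le> M\<close> have "M - j = Suc (M - Suc j)" by simp
      then show ?thesis
        by (simp add: numeral_2_eq_2 power_add algebra_simps)
    qed (simp add: numeral_2_eq_2 power_add algebra_simps qbinomial_eq_0)
  qed
  finally show ?case
    by (subst sum.atMost_Suc_shift) (simp add: numeral_2_eq_2)
qed (simp add: numeral_2_eq_2)

lemma int_mult_choose_two: "2 * int (n choose 2) = int n * (int n - 1)"
proof (cases n)
  case (Suc m)
  have "2 * (n choose 2) = n * (n - 1)"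
    unfolding choose_two by (cases "even n") auto
  then have "int (2 * (n choose 2)) = int (n * (n - 1))" by simp
  then show ?thesis by (simp add: Suc algebra_simps)
qed simp

section \<open>Finite form of the triple product\<close>

text \<open>In the upper half of the factors \<open>Q ^ n\<close> is pulled out, in the lower half
  \<open>- (fps_X ^ i * Q ^ k)\<close>. What remains is one finite product for \<open>i\<close> and,
  in reversed order, one for \<open>2 * h - i\<close>.\<close>

lemma prod_fps_X_power_diff:
  fixes h i n :: nat
  assumes "i < 2 * h"
  defines "Q \<equiv> fps_X ^ (2 * h) :: 'a::idom fps"
  shows "(\<Prod>k<2 * n. Q ^ n + (- (fps_X ^ i)) * Q ^ k)
    = (- 1) ^ n * fps_X ^ (i * n + 2 * h * (n choose 2) + 2 * h * n * n)
      * ((\<Prod>k<n. 1 - fps_X ^ i * Q ^ k) * (\<Prod>k<n. 1 - fps_X ^ (2 * h - i) * Q ^ k))"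
proof -
  have "(\<Prod>k<n. Q ^ n + (- (fps_X ^ i)) * Q ^ k)
      = (\<Prod>k<n. - (fps_X ^ i * Q ^ k) * (1 - fps_X ^ (2 * h - i) * Q ^ (n - Suc k)))"
  proof (intro prod.cong refl)
    fix k assume "k \<in> {..<n}"
    then obtain t where "n = k + Suc t"
      using less_imp_Suc_add by fastforce
    then have "i + 2 * h * k + (2 * h - i) + 2 * h * (n - Suc k) = 2 * h * n"
      using assms(1) by (simp add: distrib_left)
    then have "fps_X ^ i * Q ^ k * (fps_X ^ (2 * h - i) * Q ^ (n - Suc k)) = Q ^ n"
      unfolding Q_def by (simp only: power_mult[symmetric] power_add[symmetric] add.assoc)
    then show "Q ^ n + (- (fps_X ^ i)) * Q ^ k
        = - (fps_X ^ i * Q ^ k) * (1 - fps_X ^ (2 * h - i) * Q ^ (n - Suc k))"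
      by (simp add: right_diff_distrib)
  qed
  also have "\<dots> = (\<Prod>k<n. - (fps_X ^ i * Q ^ k)) * (\<Prod>k<n. 1 - fps_X ^ (2 * h - i) * Q ^ k)"
    unfolding prod.distrib by (subst prod.nat_diff_reindex) (rule refl)
  also have "(\<Prod>k<n. - (fps_X ^ i * Q ^ k)) = (- 1) ^ n * fps_X ^ (i * n + 2 * h * (n choose 2))"
    by (induction n)
      (simp_all add: Q_def numeral_2_eq_2 power_add algebra_simps flip: power_mult)
  finally have 1: "(\<Prod>k<n. Q ^ n + (- (fps_X ^ i)) * Q ^ k)
      = (- 1) ^ n * fps_X ^ (i * n + 2 * h * (n choose 2))
        * (\<Prod>k<n. 1 - fps_X ^ (2 * h - i) * Q ^ k)" .
  have "(\<Prod>k<n. Q ^ n + (- (fps_X ^ i)) * Q ^ (n + k)) = (\<Prod>k<n. Q ^ n * (1 - fps_X ^ i * Q ^ k))"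
    by (intro prod.cong refl) (simp add: power_add algebra_simps)
  also have "\<dots> = fps_X ^ (2 * h * n * n) * (\<Prod>k<n. 1 - fps_X ^ i * Q ^ k)"
    by (simp add: prod.distrib Q_def flip: power_mult)
  finally show ?thesis
    unfolding mult_2[of n] prod_lessThan_add 1 by (simp add: power_add mult_ac)
qed

text \<open>Expand the preceding product of \<open>2 * n\<close> factors by the q-binomial theorem,
  centre the summation index at \<open>n\<close>, and cancel the common monomial
  \<open>c\<close>.\<close>

lemma finite_jacobi_triple_product:
  fixes h i n :: nat
  assumes "0 < i" "i < 2 * h"
  defines "Q \<equiv> fps_X ^ (2 * h) :: 'a::idom fps"
  shows "(\<Prod>k<n. 1 - fps_X ^ i * Q ^ k) * (\<Prod>k<n. 1 - fps_X ^ (2 * h - i) * Q ^ k)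
    = (\<Sum>l\<in>{- int n..int n}. (if even l then 1 else - 1)
        * fps_X ^ nat (int h * l * (l - 1) + int i * l) * qbinomial Q (2 * n) (nat (int n + l)))"
    (is "?P = (\<Sum>l\<in>_. ?t l)")
proof -
  define c :: "'a fps"
    where "c = (- 1) ^ n * fps_X ^ (i * n + 2 * h * (n choose 2) + 2 * h * n * n)"
  let ?s = "\<lambda>j. qbinomial Q (2 * n) j * Q ^ (j choose 2) * (Q ^ n) ^ (2 * n - j) * (- (fps_X ^ i)) ^ j"
  have summand: "?s j = c * ?t (int j - int n)" if "j \<le> 2 * n" for j
  proof -
    define l where "l = int j - int n"
    have j: "int j = int n + l" by (simp add: l_def)
    have "0 \<le> int h * l * (l - 1) + int i * l"
      using theta_exponent_ge[OF assms(1,2), of l] by linarith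
    moreover have "int h * l * (l - 1) + int i * l
        + int (i * n + 2 * h * (n choose 2) + 2 * h * n * n)
      = int (2 * h * (j choose 2) + 2 * h * n * (2 * n - j) + i * j)"
    proof -
      have "int (2 * h * (j choose 2) + 2 * h * n * (2 * n - j) + i * j)
          = int h * (2 * int (j choose 2)) + 2 * int h * int n * (2 * int n - int j) + int i * int j"
        unfolding of_nat_add of_nat_mult of_nat_diff[OF that] by (simp add: algebra_simps)
      also have "\<dots> = int h * l * (l - 1) + int i * l
          + (int i * int n + int h * (2 * int (n choose 2)) + 2 * int h * int n * int n)"
        unfolding int_mult_choose_two j by (simp add: algebra_simps)
      finally show ?thesis by simp
    qed
    ultimately have e: "2 * h * (j choose 2) + 2 * h * n * (2 * n - j) + i * j
        = (i * n + 2 * h * (n choose 2) + 2 * h * n * n) + nat (int h * l * (l - 1) + int i * l)"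
      by linarith
    have "?s j = (- 1) ^ j * qbinomial Q (2 * n) j
        * fps_X ^ (2 * h * (j choose 2) + 2 * h * n * (2 * n - j) + i * j)"
      unfolding Q_def power_minus[of "fps_X ^ i"] power_mult[symmetric] power_add by (simp add: mult_ac)
    moreover have "(- 1) ^ j = (- 1) ^ n * (if even l then 1 else - 1 :: 'a fps)"
      using j by (auto simp: minus_one_power_iff l_def)
    moreover have "nat (int n + l) = j"
      using j by simp
    ultimately show ?thesis
      unfolding e l_def[symmetric] c_def by (simp add: power_add mult_ac)
  qed
  have "c * ?P = (\<Sum>j\<le>2 * n. ?s j)"
    unfolding c_def Q_def prod_fps_X_power_diff[OF assms(2), symmetric] qbinomial_theorem ..
  also have "\<dots> = (\<Sum>j\<le>2 * n. c * ?t (int j - int n))"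
    using summand by (intro sum.cong) auto
  also have "\<dots> = c * (\<Sum>l\<in>{- int n..int n}. ?t l)"
    unfolding sum_distrib_left
    by (rule sum.reindex_bij_witness[of _ "\<lambda>l. nat (l + int n)" "\<lambda>j. int j - int n"]) auto
  finally show ?thesis
    by (simp add: c_def)
qed

section \<open>Passage from the finite to the infinite triple product\<close>

lemma theta_mod_X_power:
  assumes "0 < i" "i < 2 * h"
  shows "fps_X ^ n dvd (theta h i :: 'a::comm_ring_1 fps)
    - (\<Sum>l\<in>{- int n..int n}. (if even l then 1 else - 1)
        * fps_X ^ nat (int h * l * (l - 1) + int i * l))"
  unfolding fps_X_power_dvd_iff
proof (intro allI impI)
  fix N assume "N < n"
  let ?e = "\<lambda>l. int h * l * (l - 1) + int i * l"
  have "(\<Sum>l\<in>{l\<in>UNIV. nat (?e l) = N}. if even l then 1 else - 1 :: 'a)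
      = (\<Sum>l\<in>{- int n..int n}. if nat (?e l) = N then (if even l then 1 else - 1) else 0)"
  proof (rule sum.mono_neutral_cong_left)
    show "{l\<in>UNIV. nat (?e l) = N} \<subseteq> {- int n..int n}"
    proof
      fix l assume "l \<in> {l\<in>UNIV. nat (?e l) = N}"
      then show "l \<in> {- int n..int n}"
        using theta_exponent_ge[OF assms, of l] \<open>N < n\<close> by auto
    qed
  qed auto
  also have "\<dots> = (\<Sum>l\<in>{- int n..int n}.
      fps_nth ((if even l then 1 else - 1) * fps_X ^ nat (?e l)) N)"
    by (intro sum.cong refl) (auto simp: fps_X_power_nth)
  finally show "fps_nth (theta h i - (\<Sum>l\<in>{- int n..int n}. (if even l then 1 else - 1)
        * fps_X ^ nat (?e l))) N = (0 :: 'a)"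
    by (simp add: theta_def psum_def fps_sum_nth)
qed

text \<open>Far from both ends, q-binomial coefficients approximate 1 / (Q; Q): in the quotient
  formula all three finite products are congruent to the infinite one, which is a unit and
  cancels.\<close>

lemma qbinomial_mod_X_power:
  fixes h :: nat
  assumes "0 < h" "r + n \<le> M" "n \<le> r"
  defines "Q \<equiv> fps_X ^ h :: 'a::field_char_0 fps"
  shows "fps_X ^ n dvd qbinomial Q M r * qpoch_inf Q Q - 1"
proof -
  let ?E = "qpoch_inf Q Q" and ?P = "\<lambda>n. \<Prod>k<n. 1 - Q * Q ^ k"
  have Q0: "fps_nth Q 0 = 0"
    using assms(1) by (simp add: Q_def fps_X_power_nth)
  have E: "fps_X ^ n dvd ?E - ?P k" if "n \<le> k" for k
    by (rule qpoch_inf_mod_X_power[OF Q0 Q0 that])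
  have "qbinomial Q M r * (?P r * ?P (M - r)) = ?P M"
    using qbinomial_mult_qpoch[of r M Q] assms(2) by (simp add: mult.assoc)
  moreover have "fps_X ^ n dvd qbinomial Q M r * (?E * ?E) - qbinomial Q M r * (?P r * ?P (M - r))"
    using assms(2,3) by (intro dvd_diff_mult E) auto
  moreover have "fps_X ^ n dvd ?P M - ?E"
    using assms(2) by (intro dvd_diff_sym[OF E]) auto
  ultimately have "fps_X ^ n dvd qbinomial Q M r * (?E * ?E) - ?E"
    using dvd_diff_trans by metis
  then have "fps_X ^ n dvd ?E * (qbinomial Q M r * ?E - 1)"
    by (simp add: algebra_simps)
  moreover have "is_unit ?E"
    using qpoch_inf_has_prod(2)[OF Q0 Q0] by simp
  ultimately show ?thesis
    by (simp add: dvd_mult_unit_iff')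
qed

theorem jacobi_triple_product:
  fixes h i :: nat
  assumes "0 < i" "i < 2 * h"
  defines "Q \<equiv> fps_X ^ (2 * h) :: 'a::field_char_0 fps"
  shows "theta h i = qpoch_inf (fps_X ^ i) Q * qpoch_inf (fps_X ^ (2 * h - i)) Q * qpoch_inf Q Q"
proof (rule fps_eqI_mod_X_power)
  fix n
  let ?E = "qpoch_inf Q Q"
  let ?c = "\<lambda>l. (if even l then 1 else - 1) * fps_X ^ nat (int h * l * (l - 1) + int i * l) :: 'a fps"
  let ?P = "\<lambda>i. \<Prod>k<n. 1 - fps_X ^ i * Q ^ k"
  have 0: "fps_nth Q 0 = 0" "fps_nth (fps_X ^ i :: 'a fps) 0 = 0"
      "fps_nth (fps_X ^ (2 * h - i) :: 'a fps) 0 = 0"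
    using assms(1,2) by (simp_all add: Q_def fps_X_power_nth)
  have "fps_X ^ n dvd (\<Sum>l\<in>{- int n..int n}. ?c l * (qbinomial Q (2 * n) (nat (int n + l)) * ?E - 1))"
  proof (rule dvd_sum)
    fix l assume l: "l \<in> {- int n..int n}"
    \<comment> \<open>The coefficient at n + l lies only n - |l| away from an end, so it is known
      only modulo X^(n - |l|); the monomial \<open>?c l\<close> makes up the missing |l|
      powers.\<close>
    let ?m = "n - nat \<bar>l\<bar>"
    have "fps_X ^ nat \<bar>l\<bar> dvd ?c l"
      using theta_exponent_ge[OF assms(1,2), of l] by (intro dvd_mult le_imp_power_dvd nat_mono)
    moreover have "fps_X ^ ?m dvd qbinomial Q (2 * n) (nat (int n + l)) * ?E - 1"
      unfolding Q_def using assms(1,2) l by (intro qbinomial_mod_X_power) auto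
    ultimately have "fps_X ^ nat \<bar>l\<bar> * fps_X ^ ?m
        dvd ?c l * (qbinomial Q (2 * n) (nat (int n + l)) * ?E - 1)"
      by (rule mult_dvd_mono)
    moreover have "nat \<bar>l\<bar> + ?m = n"
      using l by auto
    ultimately show "fps_X ^ n dvd ?c l * (qbinomial Q (2 * n) (nat (int n + l)) * ?E - 1)"
      by (simp only: power_add[symmetric])
  qed
  also have "(\<Sum>l\<in>{- int n..int n}. ?c l * (qbinomial Q (2 * n) (nat (int n + l)) * ?E - 1))
      = ?P i * ?P (2 * h - i) * ?E - (\<Sum>l\<in>{- int n..int n}. ?c l)"
    unfolding Q_def finite_jacobi_triple_product[OF assms(1,2)]
    by (simp add: sum_distrib_right sum_subtractf right_diff_distrib mult.assoc)
  finally have 1: "fps_X ^ n dvd (\<Sum>l\<in>{- int n..int n}. ?c l) - ?P i * ?P (2 * h - i) * ?E"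
    by (rule dvd_diff_sym)
  have "fps_X ^ n dvd ?P i * ?P (2 * h - i) * ?E
      - qpoch_inf (fps_X ^ i) Q * qpoch_inf (fps_X ^ (2 * h - i)) Q * ?E"
    using 0 by (intro dvd_diff_mult dvd_diff_sym[OF qpoch_inf_mod_X_power]) auto
  with 1 show "fps_X ^ n dvd theta h i
      - qpoch_inf (fps_X ^ i) Q * qpoch_inf (fps_X ^ (2 * h - i)) Q * ?E"
    using theta_mod_X_power[OF assms(1,2), of n] dvd_diff_trans by blast
qed

section \<open>Rogers' modular equation\<close>

text \<open>The hypotheses on products are parity splittings with \<open>x\<close> in the role of q.
  Apart from \<open>T43\<close> and \<open>T21\<close>, each right-hand side factors through G5, G1
  - x^2 G9, G3 - x G7 and their conjugates.\<close>

lemma theta_relations: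
  fixes U V T1 T2 T3 T4 T5 x G1 G3 G5 G7 G9 :: "'a::idom"
  assumes T43: "T4 * T3 = G3 * G1 - x ^ 3 * (G7 * G9)"
    and T21: "T2 * T1 = G7 * G1 - x * (G3 * G9)"
    and T32: "T3 * T2 = G5 * G1 - x ^ 2 * (G5 * G9)"
    and T41: "T4 * T1 = G5 * G3 - x * (G5 * G7)"
    and T54: "T5 * T4 = G1 * G1 - x ^ 4 * (G9 * G9)"
    and T52: "T5 * T2 = G3 * G3 - x ^ 2 * (G7 * G7)"
    and U: "U * (T2 * T3) = T1 * T4" and V: "V * T4 = T2"
    and nz: "T3 \<noteq> 0" "T4 \<noteq> 0" "V \<noteq> 0"
  shows "T1 = U * V * T3"
    and "T3 * (1 - x * U * V ^ 2) = U * T5"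
    and "T3 * (1 + x * U * V ^ 2) * U = V * T5"
proof -
  have "T4 * T1 = T4 * (U * V * T3)"
    using U unfolding V[symmetric] by (simp only: mult_ac)
  then show T1: "T1 = U * V * T3"
    using nz by simp
  \<comment> \<open>Neither \<open>T43\<close> nor \<open>T21\<close> factors alone, but these two
    combinations do. Multiplying by a suitable product of thetas completes each factor to a
    difference of squares, that is, to \<open>T54\<close> or \<open>T52\<close>.\<close>
  have m: "T4 * T3 - x * (T2 * T1) = (G1 + x ^ 2 * G9) * (G3 - x * G7)"
    and p: "T4 * T3 + x * (T2 * T1) = (G1 - x ^ 2 * G9) * (G3 + x * G7)"
    unfolding T43 T21 by (simp_all add: algebra_simps power2_eq_square power3_eq_cube)
  have "(T4 * T3 - x * (T2 * T1)) * (T3 * T2) = (T4 * T1) * (T5 * T4)"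
    unfolding m T32 T41 T54 by (simp add: algebra_simps power2_eq_square power4_eq_xxxx)
  also have "(T4 * T3 - x * (T2 * T1)) * (T3 * T2) = (V * T3 * T4 ^ 2) * (T3 * (1 - x * U * V ^ 2))"
    unfolding T1 V[symmetric] by (simp add: algebra_simps power2_eq_square)
  also have "(T4 * T1) * (T5 * T4) = (V * T3 * T4 ^ 2) * (U * T5)"
    unfolding T1 by (simp add: power2_eq_square)
  finally show "T3 * (1 - x * U * V ^ 2) = U * T5"
    using nz by simp
  have "(T4 * T3 + x * (T2 * T1)) * (T4 * T1) = (T3 * T2) * (T5 * T2)"
    unfolding p T32 T41 T52 by (simp add: algebra_simps power2_eq_square)
  also have "(T4 * T3 + x * (T2 * T1)) * (T4 * T1)
      = (V * T3 * T4 ^ 2) * (T3 * (1 + x * U * V ^ 2) * U)"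
    unfolding T1 V[symmetric] by (simp add: algebra_simps power2_eq_square)
  also have "(T3 * T2) * (T5 * T2) = (V * T3 * T4 ^ 2) * (V * T5)"
    unfolding V[symmetric] by (simp add: power2_eq_square)
  finally show "T3 * (1 + x * U * V ^ 2) * U = V * T5"
    using nz by simp
qed

text \<open>Crossing \<open>m\<close> with \<open>p\<close> eliminates T3 and T5 and leaves the
  modular equation. Multiplying them produces 1 - k^2 next to T5^2, which \<open>E\<close> trades
  for the eta quotient b / a.\<close>

lemma modular_equation_of_theta_relations:
  fixes U V T1 T3 T5 x a b :: "'a::idom"
  assumes T1: "T1 = U * V * T3"
    and m: "T3 * (1 - x * U * V ^ 2) = U * T5"
    and p: "T3 * (1 + x * U * V ^ 2) * U = V * T5"
    and E: "b * (T1 * T3) = T5 ^ 2 * a"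
    and nz: "T3 \<noteq> 0" "T5 \<noteq> 0" "U \<noteq> 0"
  shows "(1 - x * U * V ^ 2) * V = (1 + x * U * V ^ 2) * U ^ 2"
    and "(1 - (x * U * V ^ 2) ^ 2) * a = U * V ^ 2 * b"
proof -
  have "T5 * ((1 - x * U * V ^ 2) * V) = (1 - x * U * V ^ 2) * (T3 * (1 + x * U * V ^ 2) * U)"
    unfolding p by simp
  also have "\<dots> = (T3 * (1 - x * U * V ^ 2)) * ((1 + x * U * V ^ 2) * U)"
    by simp
  also have "\<dots> = T5 * ((1 + x * U * V ^ 2) * U ^ 2)"
    unfolding m by (simp add: power2_eq_square)
  finally show "(1 - x * U * V ^ 2) * V = (1 + x * U * V ^ 2) * U ^ 2"
    using nz by simp
  have "(U * T3 ^ 2) * ((1 - (x * U * V ^ 2) ^ 2) * a)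
      = (T3 * (1 - x * U * V ^ 2)) * (T3 * (1 + x * U * V ^ 2) * U) * a"
    by (simp add: algebra_simps power2_eq_square)
  also have "\<dots> = U * V * (T5 ^ 2 * a)"
    unfolding m p by (simp add: power2_eq_square)
  also have "\<dots> = (U * T3 ^ 2) * (U * V ^ 2 * b)"
    unfolding E[symmetric] T1 by (simp add: power2_eq_square)
  finally show "(1 - (x * U * V ^ 2) ^ 2) * a = U * V ^ 2 * b"
    using nz by simp
qed

text \<open>Eliminating \<open>U\<close>, \<open>V\<close>, \<open>W\<close> leaves a cubic relation between \<open>k\<close> and \<open>m\<close>.  It has a linear
  factor, which does not vanish on power series, and the remaining quadratic factor is what both
  conclusions reduce to.\<close>

lemma modular_relations:
  fixes q U V W :: "'a::idom"
  defines "k \<equiv> q * U * V ^ 2" and "m \<equiv> q ^ 2 * V * W ^ 2"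
  assumes h1: "(1 - k) * V = (1 + k) * U ^ 2" and h2: "(1 - m) * W = (1 + m) * V ^ 2"
    and nz: "V \<noteq> 0" "1 + k \<noteq> 0" "1 + m \<noteq> 0" "(1 + m) * k + (1 - m) \<noteq> 0"
  shows "V + q ^ 2 * U ^ 2 * V * W ^ 2 - U ^ 2 + q ^ 2 * V ^ 2 * W ^ 2 = 2 * q * U * V * W"
    and "(U ^ 2 - q ^ 2 * V ^ 2 * W ^ 2) * (1 - k ^ 2) * W = U ^ 2 * V ^ 2 * (1 - m ^ 2)"
proof -
  have k2: "k ^ 2 = q ^ 2 * U ^ 2 * V ^ 4"
    by (simp add: k_def power_mult_distrib flip: power_mult)
  have k: "k ^ 2 * (1 + k) = q ^ 2 * V ^ 5 * (1 - k)"
  proof -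
    have "k ^ 2 * (1 + k) = q ^ 2 * V ^ 4 * ((1 + k) * U ^ 2)"
      unfolding k2 by (simp only: mult_ac)
    then show ?thesis
      unfolding h1[symmetric] by (simp add: eval_nat_numeral mult_ac)
  qed
  have m: "m * (1 - m) ^ 2 = q ^ 2 * V ^ 5 * (1 + m) ^ 2"
  proof -
    have "m * (1 - m) ^ 2 = q ^ 2 * V * W ^ 2 * (1 - m) ^ 2"
      by (simp add: m_def)
    also have "\<dots> = q ^ 2 * V * ((1 - m) * W) ^ 2"
      by (simp only: power_mult_distrib mult_ac)
    finally show ?thesis
      unfolding h2 by (simp add: power_mult_distrib eval_nat_numeral mult_ac)
  qed
  \<comment> \<open>Both relations above contain \<open>q ^ 2 * V ^ 5\<close>; eliminating it makes
    this cubic vanish.\<close>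
  have "((1 + m) * k + (1 - m)) * (k ^ 2 * (1 + m) + 2 * m * k - m * (1 - m))
      = k ^ 2 * (1 + k) * (1 + m) ^ 2 - m * (1 - m) ^ 2 * (1 - k)"
    by (simp add: algebra_simps power2_eq_square)
  also have "\<dots> = 0"
    unfolding k m by (simp add: mult_ac)
  finally have quad: "k ^ 2 * (1 + m) + 2 * m * k - m * (1 - m) = 0"
    using nz by simp
  have mV: "q ^ 2 * V ^ 2 * W ^ 2 = m * V" "q ^ 2 * U ^ 2 * V * W ^ 2 = m * U ^ 2"
    by (simp_all add: m_def power2_eq_square mult_ac)
  \<comment> \<open>The multiplier is chosen so that \<open>h1\<close> can replace
    \<open>U ^ 2\<close> and \<open>h2\<close> can replace \<open>V ^ 2\<close>; the result is then
    a multiple of the quadratic factor.\<close>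
  have "(V * V * (1 + k) * (1 + m)) * (V + m * U ^ 2 - U ^ 2 + m * V - 2 * q * U * V * W)
      = V ^ 2 * (1 + m) * ((1 + k) * V * (1 + m) - (1 - m) * ((1 + k) * U ^ 2))
        - 2 * V * (1 + k) * (1 + m) * (q * U * V ^ 2) * W"
    by (simp add: algebra_simps power2_eq_square)
  also have "\<dots> = 2 * V * ((k + m) * ((1 + m) * V ^ 2) - (1 + k) * (1 + m) * k * W)"
    unfolding h1[symmetric] k_def[symmetric] by (simp add: algebra_simps power2_eq_square)
  also have "\<dots> = - 2 * V * W * (k ^ 2 * (1 + m) + 2 * m * k - m * (1 - m))"
    unfolding h2[symmetric] by (simp add: algebra_simps power2_eq_square)
  also have "\<dots> = 0"
    unfolding quad by simp
  finally show "V + q ^ 2 * U ^ 2 * V * W ^ 2 - U ^ 2 + q ^ 2 * V ^ 2 * W ^ 2 = 2 * q * U * V * W"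
    unfolding mV using nz by simp
  have "(1 + k) * ((U ^ 2 - m * V) * (1 - k ^ 2)) - (1 + k) * (U ^ 2 * (1 - m) ^ 2)
      = ((1 + k) * U ^ 2) * ((1 - k ^ 2) - (1 - m) ^ 2) - (1 + k) * m * V * (1 - k ^ 2)"
    by (simp add: algebra_simps)
  also have "\<dots> = - V * (1 - k) * (k ^ 2 * (1 + m) + 2 * m * k - m * (1 - m))"
    unfolding h1[symmetric] by (simp add: algebra_simps power2_eq_square)
  also have "\<dots> = 0"
    unfolding quad by simp
  finally have "(U ^ 2 - m * V) * (1 - k ^ 2) = U ^ 2 * (1 - m) ^ 2"
    using nz by simp
  then have "(U ^ 2 - q ^ 2 * V ^ 2 * W ^ 2) * (1 - k ^ 2) * W = U ^ 2 * (1 - m) * ((1 - m) * W)"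
    unfolding mV by (simp add: power2_eq_square)
  then show "(U ^ 2 - q ^ 2 * V ^ 2 * W ^ 2) * (1 - k ^ 2) * W = U ^ 2 * V ^ 2 * (1 - m ^ 2)"
    unfolding h2 by (simp add: algebra_simps power2_eq_square)
qed

section \<open>The Rogers--Ramanujan continued fraction\<close>

text \<open>Residues modulo 10 refine all products of base q, q^2, q^5 and q^10 at once. The
  dilation \<open>s\<close> stands for replacing q by q^s.\<close>

definition qpoch10 :: "nat \<Rightarrow> nat \<Rightarrow> 'a::field_char_0 fps" where
  "qpoch10 s n = qpoch_inf (fps_X ^ (s * n)) (fps_X ^ (s * 10))"

lemma qpoch10_nth_0: "0 < s \<Longrightarrow> 0 < n \<Longrightarrow> fps_nth (qpoch10 s n) 0 = 1"
  unfolding qpoch10_def by (rule qpoch_inf_has_prod(2)) (simp_all add: fps_X_power_nth)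

lemma qpoch_inf_eq_prod_qpoch10:
  assumes "0 < s" "0 < a" "0 < b" "b * m = 10"
  shows "qpoch_inf (fps_X ^ (s * a)) (fps_X ^ (s * b)) = (\<Prod>j<m. qpoch10 s (a + b * j))"
proof -
  have "0 < m" using assms(4) by (cases m) auto
  then have "qpoch_inf (fps_X ^ (s * a)) (fps_X ^ (s * b) :: 'a fps) =
      (\<Prod>j<m. qpoch_inf (fps_X ^ (s * a) * (fps_X ^ (s * b)) ^ j) ((fps_X ^ (s * b)) ^ m))"
    using assms by (intro qpoch_inf_dissect) (auto simp: fps_X_power_nth)
  also have "\<dots> = (\<Prod>j<m. qpoch10 s (a + b * j))"
    unfolding qpoch10_def assms(4)[symmetric]
    by (simp add: power_add distrib_left mult.assoc flip: power_mult)
  finally show ?thesis .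
qed

lemma theta_eq_qpoch10:
  assumes "0 < s" "0 < j" "j < 10"
  shows "theta (5 * s) (s * j)
    = (qpoch10 s j * qpoch10 s (10 - j) * qpoch10 s 10 :: 'a::field_char_0 fps)"
proof -
  have eqs: "2 * (5 * s) = s * 10" "s * 10 - s * j = s * (10 - j)"
    by (simp, simp only: diff_mult_distrib2)
  have "0 < s * j" "s * j < 2 * (5 * s)"
    using assms unfolding eqs(1) by simp_all
  then show ?thesis
    using jacobi_triple_product[of "s * j" "5 * s", where 'a = 'a] unfolding eqs qpoch10_def by blast
qed

lemma divide_mult_cancel_unit:
  fixes a b :: "'a::field_char_0 fps"
  assumes "fps_nth b 0 = 1"
  shows "a / b * b = a"
  using assms by (simp add: dvd_div_mult_self unit_imp_dvd)

lemma prod_lessThan_2: "prod f {..<2 :: nat} = f 0 * f 1"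
  for f :: "nat \<Rightarrow> 'a::comm_monoid_mult"
  by (simp add: eval_nat_numeral)

lemma prod_lessThan_5: "prod f {..<5 :: nat} = f 0 * f 1 * f 2 * f 3 * f 4"
  for f :: "nat \<Rightarrow> 'a::comm_monoid_mult"
  by (simp add: eval_nat_numeral)

lemma prod_lessThan_10:
  "prod f {..<10 :: nat} = f 0 * f 1 * f 2 * f 3 * f 4 * f 5 * f 6 * f 7 * f 8 * f 9"
  for f :: "nat \<Rightarrow> 'a::comm_monoid_mult"
  by (simp add: eval_nat_numeral)

text \<open>R(q) has base q^5, so each of its products splits in two modulo 10; R(q^2) already has
  base q^10.\<close>

lemma R_fun_eq_qpoch10:
  fixes s :: nat
  assumes "0 < s"
  defines "P \<equiv> qpoch10 s :: nat \<Rightarrow> 'a::field_char_0 fps"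
  shows "R_fun (fps_X ^ s) * (P 2 * P 7 * (P 3 * P 8)) = P 1 * P 6 * (P 4 * P 9)"
    and "R_fun ((fps_X ^ s) ^ 2) * (P 4 * P 6) = P 2 * P 8"
proof -
  have P0: "fps_nth (P n) 0 = 1" if "0 < n" for n
    unfolding P_def using qpoch10_nth_0[OF assms(1) that] .
  have R1: "R_fun (fps_X ^ s) = P 1 * P 6 * (P 4 * P 9) / (P 2 * P 7 * (P 3 * P 8))"
  proof -
    note d = qpoch_inf_eq_prod_qpoch10[OF assms(1), unfolded power_mult, where 'a = 'a, folded P_def]
    have "qpoch_inf (fps_X ^ s) ((fps_X ^ s) ^ 5) = P 1 * P 6"
        "qpoch_inf ((fps_X ^ s) ^ 2) ((fps_X ^ s) ^ 5) = P 2 * P 7"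
        "qpoch_inf ((fps_X ^ s) ^ 3) ((fps_X ^ s) ^ 5) = P 3 * P 8"
        "qpoch_inf ((fps_X ^ s) ^ 4) ((fps_X ^ s) ^ 5) = P 4 * P 9"
      using d[of 1 5 2] d[of 2 5 2] d[of 3 5 2] d[of 4 5 2]
      by (simp_all add: prod_lessThan_2 del: One_nat_def add_2_eq_Suc)
    then show ?thesis
      by (simp add: R_fun_def qpochs_inf_def)
  qed
  show "R_fun (fps_X ^ s) * (P 2 * P 7 * (P 3 * P 8)) = P 1 * P 6 * (P 4 * P 9)"
    unfolding R1 by (rule divide_mult_cancel_unit) (simp add: P0)
  have R2: "R_fun ((fps_X ^ s) ^ 2) = P 2 * P 8 / (P 4 * P 6)"
    unfolding P_def qpoch10_def R_fun_def qpochs_inf_def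
    by (simp add: power_mult[symmetric] mult.commute[of 4 s] mult.commute[of 6 s]
        mult.commute[of 8 s] mult.commute[of 10 s])
  show "R_fun ((fps_X ^ s) ^ 2) * (P 4 * P 6) = P 2 * P 8"
    unfolding R2 by (rule divide_mult_cancel_unit) (simp add: P0)
qed

lemma R_fun_nth_0:
  assumes "0 < s"
  shows "fps_nth (R_fun (fps_X ^ s) :: 'a::field_char_0 fps) 0 = 1"
proof -
  have "fps_nth (R_fun (fps_X ^ s) * (qpoch10 s 2 * qpoch10 s 7 * (qpoch10 s 3 * qpoch10 s 8)) :: 'a fps) 0 = 1"
    unfolding R_fun_eq_qpoch10(1)[OF assms] by (simp add: qpoch10_nth_0[OF assms])
  then show ?thesis
    by (simp add: qpoch10_nth_0[OF assms])
qed

lemma E_fun_eq_qpoch10: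
  fixes s :: nat
  assumes "0 < s"
  defines "P \<equiv> qpoch10 s :: nat \<Rightarrow> 'a::field_char_0 fps"
  shows "E_fun (fps_X ^ s) = P 1 * P 2 * P 3 * P 4 * P 5 * P 6 * P 7 * P 8 * P 9 * P 10"
    and "E_fun ((fps_X ^ s) ^ 2) = P 2 * P 4 * P 6 * P 8 * P 10"
    and "E_fun ((fps_X ^ s) ^ 5) = P 5 * P 10"
    and "E_fun ((fps_X ^ s) ^ 10) = P 10"
proof -
  note d = qpoch_inf_eq_prod_qpoch10[OF assms(1), unfolded power_mult, where 'a = 'a, folded P_def]
  show "E_fun (fps_X ^ s) = P 1 * P 2 * P 3 * P 4 * P 5 * P 6 * P 7 * P 8 * P 9 * P 10"
    using d[of 1 1 10] by (simp add: E_fun_def prod_lessThan_10 del: One_nat_def add_2_eq_Suc)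
  show "E_fun ((fps_X ^ s) ^ 2) = P 2 * P 4 * P 6 * P 8 * P 10"
    using d[of 2 2 5] by (simp add: E_fun_def prod_lessThan_5 del: One_nat_def add_2_eq_Suc)
  show "E_fun ((fps_X ^ s) ^ 5) = P 5 * P 10"
    using d[of 5 5 2] by (simp add: E_fun_def prod_lessThan_2 del: One_nat_def add_2_eq_Suc)
  show "E_fun ((fps_X ^ s) ^ 10) = P 10"
    using d[of 10 10 1] by (simp add: E_fun_def)
qed

text \<open>Stated for q^s because the final elimination combines the cases s = 1 and s = 2.\<close>

lemma R_fun_modular_equation:
  fixes s :: nat
  assumes "0 < s"
  defines "x \<equiv> fps_X ^ s :: 'a::field_char_0 fps"
  defines "U \<equiv> R_fun x" and "V \<equiv> R_fun (x ^ 2)"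
  shows "(1 - x * U * V ^ 2) * V = (1 + x * U * V ^ 2) * U ^ 2"
    and "(1 - (x * U * V ^ 2) ^ 2) * (E_fun x * E_fun (x ^ 10) ^ 5)
      = U * V ^ 2 * (E_fun (x ^ 2) * E_fun (x ^ 5) ^ 5)"
proof -
  let ?P = "qpoch10 s :: nat \<Rightarrow> 'a fps"
  define T where "T = (\<lambda>j. theta (5 * s) (s * j) :: 'a fps)"
  define G where "G = (\<lambda>j. gauss_sum (5 * s) (s * j) :: 'a fps)"
  have T: "T j = ?P j * ?P (10 - j) * ?P 10" if "0 < j" "j < 10" for j
    unfolding T_def using theta_eq_qpoch10[OF assms(1) that] .
  have T0: "T j \<noteq> 0" if "0 < j" "j < 10" for j
  proof -
    have "fps_nth (T j) 0 = 1"
      using that by (simp add: T qpoch10_nth_0[OF assms(1)])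
    then show ?thesis by auto
  qed
  have TT: "T i * T j = G (10 - i - j) * G (i - j) - x ^ j * (G (i + j) * G (10 - i + j))"
    if "0 < j" "j < i" "i + j < 10" for i j
  proof -
    have "s * i + s * j < 2 * (5 * s)"
      using assms(1) that(3) mult_less_mono2[of "i + j" 10 s] by (simp add: distrib_left)
    moreover have "2 * (5 * s) - s * i - s * j = s * (10 - i - j)"
        "2 * (5 * s) - s * i + s * j = s * (10 - i + j)"
      by (simp_all add: diff_mult_distrib2 distrib_left)
    ultimately show ?thesis
      using theta_mult_theta[of "s * j" "s * i" "5 * s", where 'a = 'a] that assms(1)
      by (simp add: T_def G_def x_def distrib_left diff_mult_distrib2 power_mult)
  qed
  have UT: "U * (T 2 * T 3) = T 1 * T 4" and VT: "V * T 4 = T 2"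
    using R_fun_eq_qpoch10[OF assms(1), where 'a = 'a]
    unfolding U_def V_def x_def by (simp_all add: T mult_ac)
  have "V \<noteq> 0" "U \<noteq> 0"
    using UT VT T0[of 1] T0[of 2] T0[of 4] by auto
  have prods: "T 4 * T 3 = G 3 * G 1 - x ^ 3 * (G 7 * G 9)"
      "T 2 * T 1 = G 7 * G 1 - x * (G 3 * G 9)"
      "T 3 * T 2 = G 5 * G 1 - x ^ 2 * (G 5 * G 9)"
      "T 4 * T 1 = G 5 * G 3 - x * (G 5 * G 7)"
      "T 5 * T 4 = G 1 * G 1 - x ^ 4 * (G 9 * G 9)"
      "T 5 * T 2 = G 3 * G 3 - x ^ 2 * (G 7 * G 7)"
    using TT[of 3 4] TT[of 1 2] TT[of 2 3] TT[of 1 4] TT[of 4 5] TT[of 2 5] by simp_all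
  have "T 3 \<noteq> 0" "T 4 \<noteq> 0"
    by (rule T0; simp)+
  note rel = theta_relations[OF prods UT VT this \<open>V \<noteq> 0\<close>]
  have power5: "y ^ 5 = y * y * y * y * y" for y :: "'a fps"
    by (simp add: eval_nat_numeral)
  \<comment> \<open>Expanded in \<open>qpoch10\<close>, both sides are the same monomial: exponent 5
    at residue 5, 8 at residue 10, and 1 elsewhere.\<close>
  have E: "E_fun (x ^ 2) * E_fun (x ^ 5) ^ 5 * (T 1 * T 3) = T 5 ^ 2 * (E_fun x * E_fun (x ^ 10) ^ 5)"
    unfolding x_def E_fun_eq_qpoch10[OF assms(1)]
    by (simp add: T power5 power2_eq_square mult_ac)
  show "(1 - x * U * V ^ 2) * V = (1 + x * U * V ^ 2) * U ^ 2"
    and "(1 - (x * U * V ^ 2) ^ 2) * (E_fun x * E_fun (x ^ 10) ^ 5)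
      = U * V ^ 2 * (E_fun (x ^ 2) * E_fun (x ^ 5) ^ 5)"
    by (rule modular_equation_of_theta_relations[OF rel E]; use T0 \<open>U \<noteq> 0\<close> in simp)+
qed

section \<open>Elimination and conclusion\<close>

text \<open>\<open>h6\<close> expresses the left-hand side through (1 - m^2) / (1 - k^2), and
  \<open>h3\<close>, \<open>h4\<close> turn this into a ratio of eta quotients. Quotients enter
  through multiplied-out equations, so the computation stays in an integral domain.\<close>

lemma eta_quotient_of_modular_relations:
  fixes q U V W S S' F D k m e1 e2 e4 e5 e10 e20 :: "'a::idom"
  assumes h3: "(1 - k ^ 2) * (e1 * e10 ^ 5) = U * V ^ 2 * (e2 * e5 ^ 5)"
    and h4: "(1 - m ^ 2) * (e2 * e20 ^ 5) = V * W ^ 2 * (e4 * e10 ^ 5)"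
    and h6: "(U ^ 2 - q ^ 2 * V ^ 2 * W ^ 2) * (1 - k ^ 2) * W = U ^ 2 * V ^ 2 * (1 - m ^ 2)"
    and D: "D = e2 ^ 2 * e5 ^ 5 * e20 ^ 5"
    and S: "S * (V * W) = U" and S': "S' * U = q ^ 2 * V * W"
    and F: "F * D = e1 * e4 * e10 ^ 10"
    and nz: "U * V * W * D \<noteq> 0" "(1 - k ^ 2) * W \<noteq> 0"
  shows "S - S' = F"
proof -
  have "(S - S') * (U * V * W) = (S * (V * W)) * U - (S' * U) * (V * W)"
    by (simp add: algebra_simps)
  then have S2: "(S - S') * (U * V * W) = U ^ 2 - q ^ 2 * V ^ 2 * W ^ 2"
    unfolding S S' by (simp add: power2_eq_square mult_ac)
  have "((1 - k ^ 2) * W) * ((U ^ 2 - q ^ 2 * V ^ 2 * W ^ 2) * D)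
      = ((U ^ 2 - q ^ 2 * V ^ 2 * W ^ 2) * (1 - k ^ 2) * W) * D"
    by (simp only: mult_ac)
  also have "\<dots> = U ^ 2 * V ^ 2 * ((1 - m ^ 2) * (e2 * e20 ^ 5)) * (e2 * e5 ^ 5)"
    unfolding h6 D power2_eq_square[of e2] by (simp only: mult_ac)
  also have "\<dots> = (U * V * W ^ 2 * e4 * e10 ^ 5) * (U * V ^ 2 * (e2 * e5 ^ 5))"
    unfolding h4 by (simp add: power2_eq_square mult_ac)
  also have "\<dots> = ((1 - k ^ 2) * W) * ((U * V * W) * (e1 * e4 * (e10 ^ 5 * e10 ^ 5)))"
    unfolding h3[symmetric] power2_eq_square[of W] by (simp only: mult_ac)
  also have "e10 ^ 5 * e10 ^ 5 = e10 ^ 10"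
    by (simp flip: power_add)
  finally have "(U ^ 2 - q ^ 2 * V ^ 2 * W ^ 2) * D = (U * V * W) * (e1 * e4 * e10 ^ 10)"
    using nz(2) by simp
  then have "(U * V * W * D) * (S - S') = (U * V * W * D) * F"
    unfolding S2[symmetric] F[symmetric] by (simp only: mult_ac)
  then show "S - S' = F"
    using nz(1) by simp
qed

text \<open>Multiplication by \<open>U * V * W\<close> turns the claim into
  \<open>h5\<close>.\<close>

lemma cleared_denominators:
  fixes q U V W S S' Z :: "'a::idom"
  assumes h5: "V + q ^ 2 * U ^ 2 * V * W ^ 2 - U ^ 2 + q ^ 2 * V ^ 2 * W ^ 2 = 2 * q * U * V * W"
    and S: "S * (V * W) = U" and S': "S' * U = q ^ 2 * V * W" and Z: "Z * (U * W) = 1"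
    and nz: "U * V * W \<noteq> 0"
  shows "(Z + q ^ 2 * U * W) - (S - S') = 2 * q"
proof -
  have "(U * V * W) * ((Z + q ^ 2 * U * W) - (S - S'))
      = (Z * (U * W)) * V + q ^ 2 * U ^ 2 * V * W ^ 2 - (S * (V * W)) * U + (S' * U) * (V * W)"
    by (simp add: algebra_simps power2_eq_square)
  also have "\<dots> = (U * V * W) * (2 * q)"
    unfolding S S' Z using h5 by (simp add: algebra_simps power2_eq_square)
  finally show ?thesis
    using nz by simp
qed

theorem theorem3p3:
  fixes q :: "'a::field_char_0 fps"
  defines "q \<equiv> fps_X"
  shows "R_fun q / (R_fun (q ^ 2) * R_fun (q ^ 4))
           - q ^ 2 * R_fun (q ^ 2) * R_fun (q ^ 4) / R_fun q
         = E_fun q * E_fun (q ^ 4) * E_fun (q ^ 10) ^ 10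
             / (E_fun (q ^ 2) ^ 2 * E_fun (q ^ 5) ^ 5 * E_fun (q ^ 20) ^ 5)
       \<and> (1 / (R_fun q * R_fun (q ^ 4)) + q ^ 2 * R_fun q * R_fun (q ^ 4))
           - (R_fun q / (R_fun (q ^ 2) * R_fun (q ^ 4))
              - q ^ 2 * R_fun (q ^ 2) * R_fun (q ^ 4) / R_fun q)
         = 2 * q"
proof -
  define U V W where "U = R_fun q" and "V = R_fun (q ^ 2)" and "W = R_fun (q ^ 4)"
  define k m where "k = q * U * V ^ 2" and "m = q ^ 2 * V * W ^ 2"
  define e where "e = (\<lambda>n. E_fun (q ^ n))"
  have U0: "fps_nth U 0 = 1" "fps_nth V 0 = 1" "fps_nth W 0 = 1"
    using R_fun_nth_0[of 1, where 'a = 'a] R_fun_nth_0[of 2, where 'a = 'a]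
      R_fun_nth_0[of 4, where 'a = 'a]
    by (simp_all add: U_def V_def W_def q_def)
  have e0: "fps_nth (e n) 0 = 1" if "0 < n" for n
    unfolding e_def E_fun_def q_def
    by (rule qpoch_inf_has_prod(2)) (use that in \<open>simp_all add: fps_X_power_nth\<close>)
  have k0: "fps_nth k 0 = 0" "fps_nth m 0 = 0"
    by (simp_all add: k_def m_def q_def fps_X_power_nth)
  have nz: "F \<noteq> 0" if "fps_nth F 0 = 1" for F :: "'a fps"
    using that by auto
  have pow: "q ^ 4 = (q ^ 2) ^ 2" "q ^ 10 = (q ^ 2) ^ 5" "q ^ 20 = (q ^ 2) ^ 10"
    by (simp_all flip: power_mult)
  \<comment> \<open>The case s = 2 moves (q, U, V) to (q^2, V, W), and hence \<open>k\<close> to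
    \<open>m\<close>.\<close>
  have h1: "(1 - k) * V = (1 + k) * U ^ 2" and h2: "(1 - m) * W = (1 + m) * V ^ 2"
    and h3: "(1 - k ^ 2) * (e 1 * e 10 ^ 5) = U * V ^ 2 * (e 2 * e 5 ^ 5)"
    and h4: "(1 - m ^ 2) * (e 2 * e 20 ^ 5) = V * W ^ 2 * (e 4 * e 10 ^ 5)"
    using R_fun_modular_equation[of 1, where 'a = 'a] R_fun_modular_equation[of 2, where 'a = 'a]
    unfolding U_def V_def W_def k_def m_def e_def pow power_one_right q_def[symmetric] by simp_all
  note h = modular_relations[of q U V W, folded k_def m_def, OF h1 h2]
  \<comment> \<open>The linear factor and the other side conditions are nonzero because
    \<open>k\<close> and \<open>m\<close> vanish at 0, which leaves constant term 1.\<close>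
  have h5: "V + q ^ 2 * U ^ 2 * V * W ^ 2 - U ^ 2 + q ^ 2 * V ^ 2 * W ^ 2 = 2 * q * U * V * W"
    and h6: "(U ^ 2 - q ^ 2 * V ^ 2 * W ^ 2) * (1 - k ^ 2) * W = U ^ 2 * V ^ 2 * (1 - m ^ 2)"
    by (rule h; rule nz; simp add: U0 k0)+
  define D where "D = e 2 ^ 2 * e 5 ^ 5 * e 20 ^ 5"
  define S where "S = U / (V * W)"
  define S' where "S' = q ^ 2 * V * W / U"
  define Z where "Z = 1 / (U * W)"
  define F where "F = e 1 * e 4 * e 10 ^ 10 / D"
  \<comment> \<open>Every divisor has constant term 1 and is thus a unit, so \<open>/\<close> is
    genuine division here.\<close>
  have S: "S * (V * W) = U" and S': "S' * U = q ^ 2 * V * W"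
    and Z: "Z * (U * W) = 1" and F: "F * D = e 1 * e 4 * e 10 ^ 10"
    unfolding S_def S'_def Z_def F_def D_def
    by (rule divide_mult_cancel_unit; simp add: U0 e0 fps_power_zeroth_eq_one)+
  have nz': "U * V * W * D \<noteq> 0" "(1 - k ^ 2) * W \<noteq> 0" "U * V * W \<noteq> 0"
    by (rule nz; simp add: U0 k0 e0 D_def fps_power_zeroth_eq_one)+
  note A = eta_quotient_of_modular_relations[OF h3 h4 h6 D_def S S' F nz'(1,2)]
  note B = cleared_denominators[OF h5 S S' Z nz'(3)]
  show ?thesis
    using A B unfolding S_def S'_def Z_def F_def D_def U_def V_def W_def e_def by simp
qed

end
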